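(* The competitive ratio of the on-line algorithm AllClass is $\Omega(\log^2 n/\log\log n)$. That is, there are absolute constants $a>0$ and $n_0$ such that for every $n\ge n_0$ there is a non-empty finite request sequence on the linear array with $n$ nodes for which the number of wavelengths used by AllClass is at least $a\,\frac{(\log_2 n)^2}{\log_2\log_2 n}$ times the number of wavelengths used by an optimal off-line algorithm on this sequence.
   Context: On-line light-trail scheduling. The network is a linear array of nodes $0,1,\dots,n-1$; link $l$ joins nodes $l$ and $l+1$. A request sequence is a sequence of events, each being the arrival of a transmission $[s,d]$ ($0\le s<d\le n-1$) with bandwidth in $(0,1]$, or the departure of a previously arrived, still active transmission. On each wavelength, shutters (ON/OFF) at the nodes divide the array into light-trails, which are segments $[u,v]$ between consecutive OFF shutters (shutters at the two end nodes are always OFF). Upon arrival a transmission $[s,d]$ must be assigned to a light-trail $[u,v]$ with $u\le s<d\le v$; at any time the total bandwidth of active transmissions assigned to a light-trail is at most $1$. Transmissions are never moved, and a light-trail is not modified while it contains active transmissions. In the splittable variation a transmission may be split into several transmissions with the same endpoints whose bandwidths sum to the original one, assigned to possibly different light-trails; in the non-splittable variation this is not allowed. The statement is for both variations. An on-line algorithm makes assignments without knowledge of later events; an off-line algorithm knows the whole sequence in advance. The number of wavelengths used by an algorithm on a sequence is the maximum over time of the number of wavelengths in use (carrying at least one active transmission); an optimal off-line algorithm minimizes this number. Classes and trail-points. A transmission belongs to class $i\ge 0$ if its length $d-s$ satisfies $2^{i-1}<d-s\le 2^i$. For class $i\ge 2$: a transmission crosses a node $u$ if $s<u<d$; its anchor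 is the smallest-numbered node that is a multiple of $2^{i-1}$ and is crossed by it; its trail-point $x$ is the largest multiple of $2^{i-1}$ smaller than its anchor; the transmission is to be served by a light-trail with extent $[x,x+2^{i+1}]$ (truncated to the array). Classes $0$ and $1$ are handled directly: $[s,s+1]$ is served by a light-trail with extent $[s,s+1]$ and $[s,s+2]$ by a light-trail with extent $[s,s+2]$. Algorithm AllClass. Wavelengths carry no labels. When a transmission $t$ arrives, let $E$ be the extent (as just defined) of the light-trail that is to serve it. The allocated wavelengths are searched in the order in which they were allocated for an existing light-trail of extent $E$ with enough spare capacity for $t$; if one is found, $t$ is assigned to the first such light-trail. Otherwise the allocated wavelengths are searched in the order of allocation for the first one whose portion over $E$ is entirely unused; if one is found, a light-trail of extent $E$ is created there and $t$ is assigned to it. Otherwise a new wavelength is allocated, a light-trail of extent $E$ is created on it, $t$ is assigned to it, and the rest of the wavelength is marked unused. (In the splittable variation, $t$ is split greedily over the existing light-trails of extent $E$ in this order, and only the remaining bandwidth is treated by the later steps.) When a transmission departs it is removed from its light-trail; if the light-trail becomes empty, its extent on the wavelength is marked unused; a wavelength that becomes completely empty is no longer counted as allocated. *)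

theory Defs
  imports Complex_Main
begin

datatype variation = Splittable | Nonsplittable

text \<open>
  \<open>Arrive s d b\<close> is the arrival of a transmission from \<open>s\<close> to \<open>d\<close> with bandwidth \<open>b\<close>.
  A transmission is named by the position of its arrival in the event list; \<open>Depart k\<close> is
  the departure of the transmission that arrived at position \<open>k\<close>.
\<close>
datatype event = Arrive nat nat real | Depart nat

definition valid_sequence :: "nat \<Rightarrow> event list \<Rightarrow> bool" where
  "valid_sequence n es \<longleftrightarrow>
     (\<forall>j < length es. case es ! j of
        Arrive s d b \<Rightarrow> s < d \<and> d \<le> n - 1 \<and> 0 < b \<and> b \<le> 1
      | Depart k \<Rightarrow> k < j \<and> (\<exists>s d b. es ! k = Arrive s d b) \<and> Depart k \<notin> set (take j es))"

text \<open>Time \<open>t\<close> is the moment just after the first \<open>t\<close> events.\<close>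
definition active :: "event list \<Rightarrow> nat \<Rightarrow> nat set" where
  "active es t =
     {k. k < t \<and> k < length es \<and> (\<exists>s d b. es ! k = Arrive s d b) \<and> Depart k \<notin> set (take t es)}"


section \<open>Off-line solutions\<close>

text \<open>The pair \<open>(u, v)\<close> stands for the segment \<open>[u,v]\<close> of the array.\<close>
type_synonym segment = "nat \<times> nat"

definition is_light_trail :: "nat set \<Rightarrow> segment \<Rightarrow> bool" where
  "is_light_trail off = (\<lambda>(u, v). u \<in> off \<and> v \<in> off \<and> u < v \<and> {u<..<v} \<inter> off = {})"

text \<open>
  \<open>off_shutters sol t w\<close> is the set of nodes whose shutter on wavelength \<open>w\<close> is OFF at time \<open>t\<close>.
  \<open>parts sol k\<close> lists the parts of transmission \<open>k\<close>, each as a wavelength, the light-trail on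
  that wavelength and the bandwidth of the part. It does not depend on time, because
  transmissions are never moved.
\<close>
record solution =
  off_shutters :: "nat \<Rightarrow> nat \<Rightarrow> nat set"
  parts :: "nat \<Rightarrow> (nat \<times> segment \<times> real) list"

definition trail_load :: "event list \<Rightarrow> solution \<Rightarrow> nat \<Rightarrow> nat \<Rightarrow> segment \<Rightarrow> real" where
  "trail_load es sol t w E =
     (\<Sum>k \<in> active es t. \<Sum>(w', E', c) \<leftarrow> parts sol k. if w' = w \<and> E' = E then c else 0)"

text \<open>
  The third conjunct requires the segment of every part to be a light-trail at all times at which
  the transmission is active. This includes the moment of its arrival, and it expresses that a
  light-trail is not modified while it contains active transmissions; the shutters are otherwise
  free to change with every event.
\<close>
definition feasible :: "variation \<Rightarrow> nat \<Rightarrow> event list \<Rightarrow> solution \<Rightarrow> bool" where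
  "feasible var n es sol \<longleftrightarrow>
     (\<forall>t \<le> length es. \<forall>w. {0, n - 1} \<subseteq> off_shutters sol t w \<and> off_shutters sol t w \<subseteq> {..<n}) \<and>
     (\<forall>k < length es. \<forall>s d b. es ! k = Arrive s d b \<longrightarrow>
        (\<forall>(w, (u, v), c) \<in> set (parts sol k). u \<le> s \<and> d \<le> v \<and> 0 < c) \<and>
        (\<Sum>(w, E, c) \<leftarrow> parts sol k. c) = b \<and>
        (var = Nonsplittable \<longrightarrow> length (parts sol k) = 1)) \<and>
     (\<forall>t \<le> length es. \<forall>k \<in> active es t. \<forall>(w, E, c) \<in> set (parts sol k).
        is_light_trail (off_shutters sol t w) E) \<and>
     (\<forall>t \<le> length es. \<forall>w E. trail_load es sol t w E \<le> 1)"

definition solution_wavelengths :: "event list \<Rightarrow> solution \<Rightarrow> nat" where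
  "solution_wavelengths es sol =
     Max ((\<lambda>t. card (\<Union>k \<in> active es t. fst ` set (parts sol k))) ` {..length es})"

definition opt_wavelengths :: "variation \<Rightarrow> nat \<Rightarrow> event list \<Rightarrow> nat" where
  "opt_wavelengths var n es =
     (LEAST m. \<exists>sol. feasible var n es sol \<and> solution_wavelengths es sol = m)"


section \<open>Classes and trail-points\<close>

text \<open>The lower bound is \<open>2 ^ (i - 1) < d - s\<close>, doubled so that it also covers \<open>i = 0\<close> in \<open>nat\<close>.\<close>
definition transmission_class :: "nat \<Rightarrow> nat \<Rightarrow> nat" where
  "transmission_class s d = (THE i. 2 ^ i < 2 * (d - s) \<and> d - s \<le> 2 ^ i)"

definition crosses :: "nat \<Rightarrow> nat \<Rightarrow> nat \<Rightarrow> bool" where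
  "crosses s d u \<longleftrightarrow> s < u \<and> u < d"

definition anchor :: "nat \<Rightarrow> nat \<Rightarrow> nat" where
  "anchor s d = (LEAST u. 2 ^ (transmission_class s d - 1) dvd u \<and> crosses s d u)"

definition trail_point :: "nat \<Rightarrow> nat \<Rightarrow> nat" where
  "trail_point s d = (GREATEST x. 2 ^ (transmission_class s d - 1) dvd x \<and> x < anchor s d)"

definition extent :: "nat \<Rightarrow> nat \<Rightarrow> nat \<Rightarrow> segment" where
  "extent n s d =
     (if transmission_class s d \<le> 1 then (s, d)
      else (trail_point s d, min (trail_point s d + 2 ^ (transmission_class s d + 1)) (n - 1)))"


section \<open>Algorithm AllClass\<close>

text \<open>
  A wavelength is the list of the active parts assigned to it, each as the extent of its
  light-trail, its transmission and its bandwidth. The light-trails on the wavelength are the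
  extents that occur in the list; everything else is unused. A state is the list of the allocated
  wavelengths in order of allocation.
\<close>
type_synonym wavelength = "(segment \<times> nat \<times> real) list"

definition has_trail :: "segment \<Rightarrow> wavelength \<Rightarrow> bool" where
  "has_trail E w \<longleftrightarrow> E \<in> fst ` set w"

definition load :: "segment \<Rightarrow> wavelength \<Rightarrow> real" where
  "load E w = (\<Sum>(E', k, c) \<leftarrow> w. if E' = E then c else 0)"

text \<open>Link \<open>l\<close> joins nodes \<open>l\<close> and \<open>l + 1\<close>.\<close>
definition links :: "segment \<Rightarrow> nat set" where
  "links = (\<lambda>(u, v). {u..<v})"

definition unused_over :: "segment \<Rightarrow> wavelength \<Rightarrow> bool" where
  "unused_over E w \<longleftrightarrow> (\<forall>(E', k, c) \<in> set w. links E' \<inter> links E = {})"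

fun add_to_first ::
  "(wavelength \<Rightarrow> bool) \<Rightarrow> segment \<times> nat \<times> real \<Rightarrow> wavelength list \<Rightarrow> wavelength list" where
  "add_to_first P p [] = []"
| "add_to_first P p (w # ws) = (if P w then (p # w) # ws else w # add_to_first P p ws)"

definition open_trail :: "segment \<Rightarrow> nat \<Rightarrow> real \<Rightarrow> wavelength list \<Rightarrow> wavelength list" where
  "open_trail E k b ws =
     (if \<exists>w \<in> set ws. unused_over E w then add_to_first (unused_over E) (E, k, b) ws
      else ws @ [[(E, k, b)]])"

definition serve_nonsplittable ::
  "segment \<Rightarrow> nat \<Rightarrow> real \<Rightarrow> wavelength list \<Rightarrow> wavelength list" where
  "serve_nonsplittable E k b ws =
     (let fits = (\<lambda>w. has_trail E w \<and> load E w + b \<le> 1)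
      in if \<exists>w \<in> set ws. fits w then add_to_first fits (E, k, b) ws else open_trail E k b ws)"

text \<open>Fills up the existing light-trails of extent \<open>E\<close> in order; also returns the bandwidth left.\<close>
fun fill_trails ::
  "segment \<Rightarrow> nat \<Rightarrow> real \<Rightarrow> wavelength list \<Rightarrow> wavelength list \<times> real" where
  "fill_trails E k b [] = ([], b)"
| "fill_trails E k b (w # ws) =
     (let c = (if has_trail E w then min b (1 - load E w) else 0);
          (ws', r) = fill_trails E k (b - c) ws
      in ((if c > 0 then (E, k, c) # w else w) # ws', r))"

definition serve_splittable ::
  "segment \<Rightarrow> nat \<Rightarrow> real \<Rightarrow> wavelength list \<Rightarrow> wavelength list" where
  "serve_splittable E k b ws =
     (let (ws', r) = fill_trails E k b ws in if r > 0 then open_trail E k r ws' else ws')"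

definition remove_transmission :: "nat \<Rightarrow> wavelength list \<Rightarrow> wavelength list" where
  "remove_transmission k ws =
     filter (\<lambda>w. w \<noteq> []) (map (filter (\<lambda>(E, k', c). k' \<noteq> k)) ws)"

fun allclass_step ::
  "variation \<Rightarrow> nat \<Rightarrow> nat \<Rightarrow> event \<Rightarrow> wavelength list \<Rightarrow> wavelength list" where
  "allclass_step Nonsplittable n j (Arrive s d b) ws = serve_nonsplittable (extent n s d) j b ws"
| "allclass_step Splittable n j (Arrive s d b) ws = serve_splittable (extent n s d) j b ws"
| "allclass_step var n j (Depart k) ws = remove_transmission k ws"

primrec allclass_state :: "variation \<Rightarrow> nat \<Rightarrow> event list \<Rightarrow> nat \<Rightarrow> wavelength list" where
  "allclass_state var n es 0 = []"
| "allclass_state var n es (Suc t) = allclass_step var n t (es ! t) (allclass_state var n es t)"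

text \<open>All wavelengths in a state are non-empty, so its length is the number in use.\<close>
definition allclass_wavelengths :: "variation \<Rightarrow> nat \<Rightarrow> event list \<Rightarrow> nat" where
  "allclass_wavelengths var n es =
     Max ((\<lambda>t. length (allclass_state var n es t)) ` {..length es})"

end

theory Submission
  imports Defs
begin

text \<open>
  All transmissions get the bandwidth \<open>1 / n\<^sup>2\<close> and at any time at most one of them is served by each
  extent, so one wavelength suffices off-line, with a single light-trail over the whole array. AllClass
  opens one light-trail per active transmission, so it becomes first fit of intervals on rows.

  Let \<open>L = log\<^sub>2 n\<close>, \<open>q \<approx> L / 4\<close> and \<open>2 ^ g \<approx> L / 2\<close>. By induction on \<open>k\<close>, an interval of
  length about \<open>2 ^ (g * k)\<close> can be brought into a state in which the rows \<open>0, \<dots>, k * q - 1\<close> all contain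
  an extent inside the interval. In the induction step the interval has \<open>2 ^ g > q\<close> subintervals. For
  \<open>j = q - 1, \<dots>, 0\<close> the first \<open>k * q\<close> rows are occupied inside a fresh subinterval, \<open>j\<close> large
  extents of different classes are stacked on top of these rows, the subinterval itself is activated
  and lands in row \<open>k * q + j\<close>, and then everything but the subinterval departs. Going downwards in
  \<open>j\<close> keeps the large extents from being blocked by the subintervals retained before. With
  \<open>k \<approx> L / (2 * g)\<close> this gives about \<open>L\<^sup>2 / log\<^sub>2 L\<close> rows.

  An empty wavelength disappears and the rows above it would move down. Hence two disjoint zones of the
  array are used alternately: while one zone is brought from nothing to \<open>(k + 1) * q\<close> rows, the other
  one, with \<open>k * q\<close> rows and \<open>q\<close> large extents stacked on top, keeps all these rows in existence.
\<close>

section \<open>First fit of extents on rows\<close>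

declare split_paired_Ex [simp del] split_paired_All [simp del]

text \<open>These are the untruncated extents of classes \<open>i >= 2\<close>; the construction
  requests no others.\<close>

definition extents :: "nat \<Rightarrow> segment set" where
  "extents n = {(x, x + 2 ^ (i + 1)) | x i. 2 \<le> i \<and> 2 ^ (i - 1) dvd x \<and> x + 2 ^ (i + 1) \<le> n - 1}"

text \<open>
  \<open>f\<close> maps each active extent to its row and \<open>H\<close> is the number of rows. The rule \<open>depart\<close> is restricted to
  departures that leave another extent in the row, so rows are never renumbered.
\<close>
inductive config :: "nat \<Rightarrow> (segment \<Rightarrow> nat option) \<Rightarrow> nat \<Rightarrow> bool" for n where
  empty: "config n Map.empty 0"
| arrive: "config n f H \<Longrightarrow> E \<in> extents n \<Longrightarrow> f E = None \<Longrightarrow> r \<le> H \<Longrightarrow>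
    (\<And>r'. r' < r \<Longrightarrow> \<exists>E'. f E' = Some r' \<and> links E' \<inter> links E \<noteq> {}) \<Longrightarrow>
    (\<And>E'. f E' = Some r \<Longrightarrow> links E' \<inter> links E = {}) \<Longrightarrow>
    config n (f(E \<mapsto> r)) (max H (Suc r))"
| depart: "config n f H \<Longrightarrow> f E = Some r \<Longrightarrow> f E' = Some r \<Longrightarrow> E' \<noteq> E \<Longrightarrow> config n (f(E := None)) H"

lemma links_nonempty: "E \<in> extents n \<Longrightarrow> links E \<noteq> {}"
  by (auto simp: extents_def links_def)

lemma config_props:
  assumes "config n f H"
  shows "(\<forall>E r. f E = Some r \<longrightarrow> r < H \<and> E \<in> extents n) \<and> finite (dom f) \<and> (\<forall>r<H. \<exists>E. f E = Some r)"
  using assms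
proof induction
  case empty
  then show ?case by simp
next
  case (arrive f H E r)
  have "\<exists>E'. (f(E \<mapsto> r)) E' = Some r'" if "r' < max H (Suc r)" for r'
  proof (cases "r' < H")
    case True
    then obtain E' where "f E' = Some r'" using arrive by blast
    moreover have "E' \<noteq> E" using calculation arrive.hyps by auto
    ultimately have "(f(E \<mapsto> r)) E' = Some r'" by simp
    then show ?thesis by blast
  next
    case False
    then have "(f(E \<mapsto> r)) E = Some r'" using that arrive.hyps by auto
    then show ?thesis by blast
  qed
  moreover have "r' < max H (Suc r) \<and> E' \<in> extents n" if "(f(E \<mapsto> r)) E' = Some r'" for E' r'
    using arrive that by (cases "E' = E") (auto simp: less_max_iff_disj)
  moreover have "finite (dom (f(E \<mapsto> r)))" using arrive by simp
  ultimately show ?case by blast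
next
  case (depart f H E r E')
  have "\<exists>F. (f(E := None)) F = Some r'" if "r' < H" for r'
  proof -
    have "\<exists>F. f F = Some r'" using depart.IH that by simp
    then obtain F where "f F = Some r'" ..
    then have "(f(E := None)) (if F = E then E' else F) = Some r'" using depart.hyps(2-4) by auto
    then show ?thesis ..
  qed
  moreover have "r' < H \<and> F \<in> extents n" if "(f(E := None)) F = Some r'" for F r'
    using depart.IH that by (cases "F = E") auto
  moreover have "finite (dom (f(E := None)))" using depart.IH by simp
  ultimately show ?case by (simp del: fun_upd_apply)
qed

lemma config_less: "config n f H \<Longrightarrow> f E = Some r \<Longrightarrow> r < H"
  and config_extents: "config n f H \<Longrightarrow> f E = Some r \<Longrightarrow> E \<in> extents n"
  and config_finite: "config n f H \<Longrightarrow> finite (dom f)"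
  and config_row: "config n f H \<Longrightarrow> r < H \<Longrightarrow> \<exists>E. f E = Some r"
  using config_props by blast+

text \<open>Departures happen one at a time. A row that loses members of \<open>D\<close> keeps its
  witness outside \<open>D\<close> throughout, so rule \<open>depart\<close> applies at every
  step.\<close>

lemma config_remove:
  assumes "finite D" "config n f H"
    and "\<And>E r. E \<in> D \<Longrightarrow> f E = Some r \<Longrightarrow> \<exists>E'. E' \<notin> D \<and> f E' = Some r"
  shows "config n (f |` (- D)) H"
  using assms
proof (induction D)
  case empty
  then show ?case by simp
next
  case (insert E D)
  have IH: "config n (f |` (- D)) H"
    using insert.IH[OF insert.prems(1)] insert.prems(2) by blast
  have eq: "f |` (- insert E D) = (f |` (- D))(E := None)"
    by (auto simp: restrict_map_def)
  show ?case
  proof (cases "f E")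
    case None
    then have "(f |` (- D))(E := None) = f |` (- D)"
      by (auto simp: restrict_map_def)
    then show ?thesis using IH eq by simp
  next
    case (Some r)
    then obtain E' where "E' \<notin> insert E D" "f E' = Some r" using insert.prems(2) by blast
    then have "config n ((f |` (- D))(E := None)) H"
      using config.depart[OF IH, of E r E'] insert.hyps Some by (auto simp: restrict_map_def)
    then show ?thesis using eq by simp
  qed
qed

section \<open>Filling many rows\<close>

text \<open>\<open>q < 2 ^ g\<close> gives at least \<open>q + 1\<close> subblocks per block;
  \<open>size\<close> gives room for two adjacent zones of length
  \<open>2 ^ (g * K + 4 + q)\<close>.\<close>

locale construction =
  fixes n g q K :: nat
  assumes q_less: "q < 2 ^ g" and size: "2 ^ (g * K + q + 5) \<le> n - 1"
begin

text \<open>The exponent 3 belongs to the shortest extent, that of class 2; each level multiplies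
  the length by \<open>2 ^ g\<close>.\<close>

definition block :: "nat \<Rightarrow> nat \<Rightarrow> segment" where
  "block k p = (p, p + 2 ^ (g * k + 3))"

text \<open>For fixed \<open>P\<close> these are nested, one class per index. The offset 4 makes
  even the smallest strictly longer than a block of level \<open>K\<close>.\<close>

definition large :: "nat \<Rightarrow> nat \<Rightarrow> segment" where
  "large P i = (P, P + 2 ^ (g * K + 4 + i))"

definition zone :: "nat \<Rightarrow> nat set" where
  "zone P = {P..<P + 2 ^ (g * K + 4 + q)}"

definition bases :: "nat set" where
  "bases = {0, 2 ^ (g * K + 4 + q)}"

primrec tower :: "nat \<Rightarrow> nat \<Rightarrow> nat \<Rightarrow> segment \<Rightarrow> nat option" where
  "tower P c 0 = Map.empty"
| "tower P c (Suc m) = (tower P c m)(large P m \<mapsto> c + m)"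

lemma large_inject [simp]: "large P i = large P j \<longleftrightarrow> i = j"
  by (simp add: large_def)

lemma tower_iff: "tower P c m E = Some r \<longleftrightarrow> (\<exists>i<m. E = large P i \<and> r = c + i)"
  by (induction m) (auto simp: less_Suc_eq)

lemma tower_None: "(\<And>i. i < m \<Longrightarrow> E \<noteq> large P i) \<Longrightarrow> tower P c m E = None"
  by (induction m) auto

lemma large_extents:
  assumes "P \<in> bases" "i < q"
  shows "large P i \<in> extents n"
proof -
  have "P + 2 ^ (g * K + 4 + i) \<le> 2 ^ (g * K + 4 + q) + 2 ^ (g * K + 4 + q)"
    using assms by (intro add_mono power_increasing) (auto simp: bases_def)
  also have "\<dots> = 2 ^ (g * K + q + 5)" by (simp add: power_add)
  finally have "P + 2 ^ (g * K + 4 + i) \<le> n - 1" using size by linarith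
  \<comment> \<open>The class is one below the exponent of the length, and trail-points are
    multiples of 2 to the class minus one; hence \<open>g * K + 2 + i\<close>.\<close>
  moreover have "(2::nat) ^ (g * K + 2 + i) dvd P"
    using assms by (auto simp: bases_def intro: le_imp_power_dvd simp del: power_Suc)
  ultimately show ?thesis unfolding extents_def large_def
    by (auto intro!: exI[of _ "g * K + 3 + i"] simp: eval_nat_numeral)
qed

lemma large_zone: "i < q \<Longrightarrow> links (large P i) \<subseteq> zone P"
  using power_increasing[of "g * K + 4 + i" "g * K + 4 + q" "2::nat"]
  by (auto simp: large_def zone_def links_def)

lemma block_large: "links (block K P) \<subset> links (large P i)"
proof -
  have "(2::nat) ^ (g * K + 3) < 2 ^ (g * K + 4 + i)" by (intro power_strict_increasing) auto
  then have "{P..<P + 2 ^ (g * K + 3)} \<subseteq> {P..<P + 2 ^ (g * K + 4 + i)}"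
    "P + 2 ^ (g * K + 3) \<in> {P..<P + 2 ^ (g * K + 4 + i)} - {P..<P + 2 ^ (g * K + 3)}"
    by auto
  then show ?thesis unfolding large_def block_def links_def prod.case by blast
qed

lemma zones_disjoint: "P \<in> bases \<Longrightarrow> P' \<in> bases \<Longrightarrow> P \<noteq> P' \<Longrightarrow> zone P \<inter> zone P' = {}"
  by (auto simp: bases_def zone_def)

text \<open>First fit skips the rows below \<open>c\<close> because of \<open>low\<close>, and the
  rows above them because the large extents placed earlier are nested with the new one. By
  \<open>gap\<close> the next row is free over the zone.\<close>

lemma config_tower:
  assumes f: "config n f H" and "P \<in> bases" "m \<le> q" "c \<le> H"
    and low: "\<And>r. r < c \<Longrightarrow> \<exists>E. f E = Some r \<and> links E \<subseteq> links (block K P)"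
    and gap: "\<And>E r. f E = Some r \<Longrightarrow> links E \<inter> zone P \<noteq> {} \<Longrightarrow> r < c \<or> c + m \<le> r"
    and fresh: "\<And>i. f (large P i) = None"
  shows "config n (f ++ tower P c m) (max H (c + m))"
  using \<open>m \<le> q\<close> gap
proof (induction m)
  case 0
  then show ?case using f \<open>c \<le> H\<close> by (simp add: max_absorb1)
next
  case (Suc m)
  let ?F = "f ++ tower P c m"
  have IH: "config n ?F (max H (c + m))"
    using Suc.IH Suc.prems by fastforce
  have E: "large P m \<in> extents n" using large_extents[of P m] assms Suc.prems by simp
  have "config n (?F(large P m \<mapsto> c + m)) (max (max H (c + m)) (Suc (c + m)))"
  proof (rule config.arrive[OF IH E])
    have "tower P c m (large P m) = None"
      by (rule tower_None) simp
    then show "?F (large P m) = None" using fresh by (simp add: map_add_def)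
    show "c + m \<le> max H (c + m)" by simp
    fix r assume r: "r < c + m"
    show "\<exists>E'. ?F E' = Some r \<and> links E' \<inter> links (large P m) \<noteq> {}"
    proof (cases "r < c")
      case True
      then obtain E where E: "f E = Some r" "links E \<subseteq> links (block K P)" using low by blast
      have "tower P c m E = None"
        using E fresh by (intro tower_None) auto
      then have "?F E = Some r" using E by (simp add: map_add_def)
      moreover have "links E \<inter> links (large P m) \<noteq> {}"
        using links_nonempty[OF config_extents[OF f E(1)]] E(2) block_large[of P m] by blast
      ultimately show ?thesis by (intro exI[of _ E]) simp
    next
      case False
      then have "tower P c m (large P (r - c)) = Some r" using r tower_iff by auto
      moreover have "links (large P (r - c)) \<inter> links (large P m) \<noteq> {}"
        using block_large[of P "r - c"] block_large[of P m] by (auto simp: links_def large_def)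
      ultimately show ?thesis by (metis map_add_Some_iff)
    qed
  next
    fix E' assume "?F E' = Some (c + m)"
    then have "f E' = Some (c + m)"
      using tower_iff[of P c m E' "c + m"] by (auto simp: map_add_Some_iff)
    then show "links E' \<inter> links (large P m) = {}"
      using Suc.prems(2)[of E' "c + m"] large_zone[of m P] Suc.prems(1) by auto
  qed
  moreover have "max (max H (c + m)) (Suc (c + m)) = max H (c + Suc m)" by simp
  ultimately show ?case by (simp only: tower.simps map_add_upd)
qed

text \<open>
  The last hypothesis provides the extents outside the zone that keep rows from vanishing.
\<close>
lemma fill_block:
  assumes "P \<in> bases" "k \<le> K" "2 ^ (g * k + 3) dvd p" "P \<le> p"
    "p + 2 ^ (g * k + 3) \<le> P + 2 ^ (g * K + 3)"
    "config n f H"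
    "\<And>E r. f E = Some r \<Longrightarrow> links E \<inter> links (block k p) = {}"
    "\<And>E r. f E = Some r \<Longrightarrow> links E \<inter> zone P \<noteq> {} \<Longrightarrow> k * q \<le> r"
    "\<And>r. r < k * q \<Longrightarrow> \<exists>E. f E = Some r \<and> links E \<inter> zone P = {}"
  shows "\<exists>h. config n (f ++ h) H \<and> (\<forall>r < k * q. \<exists>E. h E = Some r) \<and>
    (\<forall>E r. h E = Some r \<longrightarrow> r < k * q \<and> links E \<subset> links (block k p))"
  using assms(2-)
proof (induction k arbitrary: p f)
  case 0
  then show ?case by (intro exI[of _ Map.empty]) simp
next
  case (Suc k)
  \<comment> \<open>Subblock 0 is reserved for the last use of the induction hypothesis, hence the
    shift by one in \<open>s\<close>. The indices 0 to \<open>q\<close> fit because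
    \<open>q < 2 ^ g\<close>.\<close>
  define sub where "sub i = p + i * 2 ^ (g * k + 3)" for i
  define s where "s i = block k (sub (Suc i))" for i
  note f = Suc.prems(5)
  have len: "(2::nat) ^ (g * Suc k + 3) = 2 ^ g * 2 ^ (g * k + 3)" by (simp add: power_add)
  have sub_le: "sub i + 2 ^ (g * k + 3) \<le> p + 2 ^ (g * Suc k + 3)" if "i \<le> q" for i
  proof -
    have "Suc i * 2 ^ (g * k + 3) \<le> 2 ^ g * 2 ^ (g * k + 3)"
      using that q_less by (intro mult_right_mono) auto
    then show ?thesis unfolding len sub_def by simp
  qed
  have sub_dvd: "2 ^ (g * k + 3) dvd sub i" for i
    using Suc.prems(2) unfolding sub_def len by (auto intro: dvd_add dvd_mult_right)
  have sub_ge: "p \<le> sub i" for i by (simp add: sub_def)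
  have sub_block: "links (block k (sub i)) \<subseteq> links (block (Suc k) p)" if "i \<le> q" for i
    using sub_le[OF that] sub_ge[of i] unfolding links_def block_def prod.case by auto
  have s_psub: "links (s i) \<subset> links (block (Suc k) p)" if "i < q" for i
  proof -
    have "p \<in> links (block (Suc k) p)" "p \<notin> links (s i)"
      by (auto simp: links_def block_def sub_def s_def)
    then show ?thesis using sub_block[of "Suc i"] that unfolding s_def by auto
  qed
  have block_K: "links (block (Suc k) p) \<subseteq> links (block K P)"
    using Suc.prems(3,4) unfolding links_def block_def prod.case by auto
  have K_zone: "links (block K P) \<subseteq> zone P"
    using power_increasing[of "g * K + 3" "g * K + 4 + q" "2::nat"]
    by (auto simp: links_def block_def zone_def)
  have disj: "links (block k (sub i)) \<inter> links (block k (sub j)) = {}" if "i < j" for i j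
  proof -
    have "Suc i * 2 ^ (g * k + 3) \<le> j * 2 ^ (g * k + 3)" using that by (intro mult_right_mono) auto
    then show ?thesis by (auto simp: links_def block_def sub_def)
  qed
  have disj': "links (block k (sub i)) \<inter> links (block k (sub j)) = {}" if "i \<noteq> j" for i j
    using disj[of i j] disj[of j i] that by (cases "i < j") auto
  have s_inj: "s i = s j \<longleftrightarrow> i = j" for i j
    by (auto simp: s_def block_def sub_def)
  have s_extents: "s i \<in> extents n" if "i < q" for i
  proof -
    have "P + 2 ^ (g * K + 3) \<le> 2 ^ (g * K + 4 + q) + 2 ^ (g * K + 4 + q)"
      using assms(1) power_increasing[of "g * K + 3" "g * K + 4 + q" "2::nat"]
      by (intro add_mono) (auto simp: bases_def)
    also have "\<dots> = 2 ^ (g * K + q + 5)" by (simp add: power_add)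
    finally have "P + 2 ^ (g * K + 3) \<le> n - 1" using size by linarith
    then have "sub (Suc i) + 2 ^ (g * k + 3) \<le> n - 1"
      using sub_le[of "Suc i"] that Suc.prems(4) by simp
    moreover have "(2::nat) ^ (g * k + 1) dvd sub (Suc i)"
      using sub_dvd[of "Suc i"] by (meson dvd_trans le_imp_power_dvd add_left_mono one_le_numeral)
    ultimately show ?thesis unfolding extents_def s_def block_def
      by (auto intro!: exI[of _ "g * k + 2"] simp: eval_nat_numeral)
  qed
  \<comment> \<open>The induction hypothesis is needed while some subblocks \<open>h'\<close> are
    retained. They lie in rows at least \<open>k * q\<close> and are disjoint from subblock
    \<open>i\<close>, so they do not disturb its premises.\<close>
  have IH: "\<exists>h. config n (f' ++ h) H \<and> (\<forall>r < k * q. \<exists>E. h E = Some r) \<and>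
      (\<forall>E r. h E = Some r \<longrightarrow> r < k * q \<and> links E \<subset> links (block k (sub i)))"
    if i: "i \<le> q" and f': "f' = f ++ h'" "config n f' H"
      and h': "\<And>E r. h' E = Some r \<Longrightarrow> k * q \<le> r \<and> (\<exists>j. j \<noteq> i \<and> j \<le> q \<and> E = block k (sub j))"
    for i f' h'
  proof (rule Suc.IH)
    show "k \<le> K" "2 ^ (g * k + 3) dvd sub i" "P \<le> sub i" "config n f' H"
      using Suc.prems(1,3) sub_dvd sub_ge[of i] f' by auto
    show "sub i + 2 ^ (g * k + 3) \<le> P + 2 ^ (g * K + 3)"
      using sub_le[OF i] Suc.prems(4) by simp
    fix E r assume "f' E = Some r"
    then consider "h' E = Some r" | "f E = Some r" using f' by auto
    then show "links E \<inter> links (block k (sub i)) = {}"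
    proof cases
      case 1
      then show ?thesis using h' disj' by blast
    next
      case 2
      then show ?thesis using Suc.prems(6) sub_block[OF i] by blast
    qed
  next
    fix E r assume "f' E = Some r" "links E \<inter> zone P \<noteq> {}"
    then show "k * q \<le> r" using f' h'[of E r] Suc.prems(7)[of E r] by auto
  next
    fix r assume "r < k * q"
    then obtain E where E: "f E = Some r" "links E \<inter> zone P = {}" using Suc.prems(8)[of r] by auto
    have "links E \<noteq> {}" by (rule links_nonempty[OF config_extents[OF f E(1)]])
    have "h' E = None"
    proof (cases "h' E")
      case (Some r')
      then obtain j where "j \<le> q" "E = block k (sub j)" using h' by blast
      then have "links E \<subseteq> zone P" using sub_block[of j] block_K K_zone by auto
      then show ?thesis using E(2) \<open>links E \<noteq> {}\<close> by blast
    qed simp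
    then show "\<exists>E. f' E = Some r \<and> links E \<inter> zone P = {}"
      using E f' by (intro exI[of _ E]) (simp add: map_add_def)
  qed
  \<comment> \<open>Downward induction from \<open>q\<close>: at stage \<open>j\<close> exactly the
    subblocks \<open>s i\<close> with \<open>j <= i < q\<close> have been added to \<open>f\<close>,
    each in its target row, and all auxiliary extents have departed again.\<close>
  have retain: "\<exists>h. config n (f ++ h) H \<and>
      (\<forall>E r. h E = Some r \<longleftrightarrow> (\<exists>i. j \<le> i \<and> i < q \<and> E = s i \<and> r = k * q + i))" if "j \<le> q" for j
    using that
  proof (induction rule: inc_induct)
    case base
    then show ?case using f by (intro exI[of _ Map.empty]) auto
  next
    case (step j)
    then obtain h where h: "config n (f ++ h) H"
      "\<And>E r. h E = Some r \<longleftrightarrow> (\<exists>i. Suc j \<le> i \<and> i < q \<and> E = s i \<and> r = k * q + i)" by blast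
    \<comment> \<open>The low rows are filled inside \<open>s j\<close> itself, so that
      \<open>s j\<close> will be blocked in each of them.\<close>
    have "\<exists>h'. config n (f ++ h ++ h') H \<and> (\<forall>r < k * q. \<exists>E. h' E = Some r) \<and>
        (\<forall>E r. h' E = Some r \<longrightarrow> r < k * q \<and> links E \<subset> links (block k (sub (Suc j))))"
    proof (rule IH[OF _ refl h(1)])
      show "Suc j \<le> q" using step.hyps by simp
      fix E r assume "h E = Some r"
      then obtain i where i: "Suc j \<le> i" "i < q" "E = s i" "r = k * q + i" using h(2) by blast
      then show "k * q \<le> r \<and> (\<exists>i. i \<noteq> Suc j \<and> i \<le> q \<and> E = block k (sub i))"
        using step.hyps by (auto simp: s_def intro!: exI[of _ "Suc i"])
    qed
    then obtain h' where h': "config n (f ++ h ++ h') H" "\<And>r. r < k * q \<Longrightarrow> \<exists>E. h' E = Some r"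
        "\<And>E r. h' E = Some r \<Longrightarrow> r < k * q" "\<And>E r. h' E = Some r \<Longrightarrow> links E \<subset> links (s j)"
      unfolding s_def by (elim exE conjE) (rule that[unfolded s_def], assumption, blast+)
    let ?F = "f ++ h ++ h'" and ?t = "tower P (k * q) j"
    let ?D = "dom h' \<union> dom ?t"
    \<comment> \<open>The extents of \<open>f\<close> outside the zone already occupy all these
      rows. Hence no row is created in this step and each \<open>max H\<close> below collapses to
      \<open>H\<close>.\<close>
    have "k * q + q \<le> H"
    proof (rule ccontr)
      assume "\<not> k * q + q \<le> H"
      then obtain E where "f E = Some H" using Suc.prems(8)[of H] by (auto simp: add.commute)
      then show False using config_less[OF f] by blast
    qed
    have sK: "links (s i) \<subseteq> links (block K P)" if "i < q" for i
      using s_psub[OF that] block_K by blast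
    have F_cases: "f E = Some r \<or> h E = Some r \<or> h' E = Some r" if "?F E = Some r" for E r
      using that by auto
    have f_tower: "f (large P i) = None" for i
    proof (cases "f (large P i)")
      case (Some r)
      have "links (large P i) \<inter> links (block (Suc k) p) \<noteq> {}"
        using block_large[of P i] block_K by (auto simp: links_def block_def)
      then show ?thesis using Suc.prems(6)[OF Some] by simp
    qed simp
    have fs: "f E = None" if "links E \<subseteq> links (block (Suc k) p)" for E
    proof (cases "f E")
      case (Some r)
      then show ?thesis using Suc.prems(6)[OF Some] that links_nonempty[OF config_extents[OF f Some]] by blast
    qed simp
    have F_large: "?F (large P i) = None" for i
    proof (cases "?F (large P i)")
      case (Some r)
      from F_cases[OF Some] consider "h (large P i) = Some r" | "h' (large P i) = Some r"
        using f_tower by auto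
      then have "links (large P i) \<subseteq> links (block K P)"
      proof cases
        case 1
        then obtain i' where "i' < q" "large P i = s i'" using h(2) by blast
        then show ?thesis using sK by simp
      next
        case 2
        then show ?thesis using h'(4) sK[OF step.hyps(2)] by blast
      qed
      then show ?thesis using block_large[of P i] by blast
    qed simp
    \<comment> \<open>The retained subblocks start at row \<open>k * q + j + 1\<close>, above the
      stack; this is where the descending order of \<open>j\<close> is used.\<close>
    have tower: "config n (?F ++ ?t) (max H (k * q + j))"
    proof (rule config_tower[OF h'(1) assms(1)])
      show "j \<le> q" "k * q \<le> H" using step.hyps \<open>k * q + q \<le> H\<close> by auto
      show "?F (large P i) = None" for i by (rule F_large)
      fix r assume "r < k * q"
      then obtain E where "h' E = Some r" using h'(2) by blast
      then show "\<exists>E. ?F E = Some r \<and> links E \<subseteq> links (block K P)"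
        using h'(4)[of E r] sK[OF step.hyps(2)] by (intro exI[of _ E]) auto
    next
      fix E r assume E: "?F E = Some r" "links E \<inter> zone P \<noteq> {}"
      show "r < k * q \<or> k * q + j \<le> r"
        using F_cases[OF E(1)]
      proof (elim disjE)
        assume "f E = Some r"
        then show ?thesis using Suc.prems(7)[OF _ E(2)] step.hyps by simp
      next
        assume "h E = Some r"
        then show ?thesis using h(2)[of E r] by auto
      next
        assume "h' E = Some r"
        then show ?thesis using h'(3) by blast
      qed
    qed
    have "max H (k * q + j) = H" using \<open>k * q + q \<le> H\<close> step.hyps by auto
    then have tower: "config n (?F ++ ?t) H" using tower by simp
    have s_tower: "?t (s i) = None" if "i < q" for i
    proof (rule tower_None)
      show "s i \<noteq> large P i'" for i' using sK[OF that] block_large[of P i'] by auto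
    qed
    \<comment> \<open>For \<open>i = j\<close> this relies on the strict inclusion in the induction
      hypothesis: filling a subblock never uses the subblock itself as an extent.\<close>
    have h'_s: "h' (s i) = None" if "i < q" for i
    proof (cases "h' (s i)")
      case (Some r)
      then have "links (s i) \<subset> links (s j)" using h'(4) by blast
      moreover have "links (s i) \<noteq> {}" by (simp add: links_def s_def block_def)
      ultimately show ?thesis using disj'[of "Suc i" "Suc j"] by (cases "i = j") (auto simp: s_def)
    qed simp
    have hj: "h (s j) = None"
      using h(2)[of "s j"] by (cases "h (s j)") (auto simp: s_inj)
    \<comment> \<open>Rows below \<open>k * q\<close> are blocked by \<open>h'\<close> and the next
      \<open>j\<close> rows by the tower. Row \<open>k * q + j\<close> holds only extents of
      \<open>f\<close>, which avoid the block, so \<open>s j\<close> lands there.\<close>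
    have new: "config n ((?F ++ ?t)(s j \<mapsto> k * q + j)) (max H (Suc (k * q + j)))"
    proof (rule config.arrive[OF tower s_extents[OF step.hyps(2)]])
      show "(?F ++ ?t) (s j) = None"
        using s_tower[OF step.hyps(2)] h'_s[OF step.hyps(2)] hj fs[of "s j"] s_psub[OF step.hyps(2)]
        by (simp add: map_add_def less_imp_le)
      show "k * q + j \<le> H" using \<open>k * q + q \<le> H\<close> step.hyps by auto
      fix r assume r: "r < k * q + j"
      show "\<exists>E'. (?F ++ ?t) E' = Some r \<and> links E' \<inter> links (s j) \<noteq> {}"
      proof (cases "r < k * q")
        case True
        then obtain E where E: "h' E = Some r" using h'(2) by blast
        then have F: "?F E = Some r" by simp
        have "?t E = None"
          using F_large F by (intro tower_None) auto
        then have "(?F ++ ?t) E = Some r" using F by (simp add: map_add_def)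
        moreover have "links E \<inter> links (s j) \<noteq> {}"
          using h'(4)[OF E] links_nonempty[OF config_extents[OF h'(1) F]] by blast
        ultimately show ?thesis by (intro exI[of _ E] conjI)
      next
        case False
        then have "?t (large P (r - k * q)) = Some r" using r tower_iff by auto
        moreover have "links (s j) \<subseteq> links (large P (r - k * q))"
          using sK[OF step.hyps(2)] block_large by blast
        moreover have "links (s j) \<noteq> {}" by (simp add: links_def s_def block_def)
        ultimately show ?thesis by (metis map_add_Some_iff inf.absorb2)
      qed
    next
      fix E assume "(?F ++ ?t) E = Some (k * q + j)"
      then have "f E = Some (k * q + j)"
        using tower_iff[of P "k * q" j E "k * q + j"] h(2)[of E "k * q + j"] h'(3)[of E "k * q + j"]
        by auto
      then show "links E \<inter> links (s j) = {}"
        using Suc.prems(6) s_psub[OF step.hyps(2)] by blast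
    qed
    have "max H (Suc (k * q + j)) = H" using \<open>k * q + q \<le> H\<close> step.hyps by auto
    then have new: "config n ((?F ++ ?t)(s j \<mapsto> k * q + j)) H" using new by simp
    have f_D: "E \<notin> ?D" if "f E = Some r" for E r
    proof
      assume "E \<in> ?D"
      then consider r' where "h' E = Some r'" | r' where "?t E = Some r'" by blast
      then show False
      proof cases
        case 1
        then have "links E \<subseteq> links (block (Suc k) p)"
          using h'(4) s_psub[OF step.hyps(2)] by blast
        then show False using fs that by simp
      next
        case 2
        then show False using tower_iff[of P "k * q" j E r'] f_tower that by auto
      qed
    qed
    \<comment> \<open>All auxiliary extents lie in rows below \<open>k * q + q\<close>, each of
      which also holds an extent of \<open>f\<close> outside the zone; their departure empties no
      row.\<close>
    have "config n (((?F ++ ?t)(s j \<mapsto> k * q + j)) |` (- ?D)) H"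
    proof (rule config_remove[OF _ new])
      show "finite ?D" using config_finite[OF tower] by (simp add: dom_map_add)
    next
      fix E r assume E: "E \<in> ?D" "((?F ++ ?t)(s j \<mapsto> k * q + j)) E = Some r"
      have "E \<noteq> s j" using E(1) s_tower[OF step.hyps(2)] h'_s[OF step.hyps(2)] by auto
      then have "(?F ++ ?t) E = Some r" using E(2) by simp
      then have "h' E = Some r \<or> ?t E = Some r" using E(1) by auto
      then have "r < k * q + q"
        using h'(3)[of E r] tower_iff[of P "k * q" j E r] step.hyps by auto
      then obtain E' where E': "f E' = Some r" "links E' \<inter> zone P = {}"
        using Suc.prems(8)[of r] by (auto simp: add.commute)
      have D: "E' \<notin> ?D" using f_D E' by blast
      have "links E' \<noteq> {}" by (rule links_nonempty[OF config_extents[OF f E'(1)]])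
      then have ns: "E' \<noteq> s i" if "i < q" for i
        using sK[OF that] K_zone E'(2) by blast
      have "h E' = None"
      proof (cases "h E'")
        case (Some r')
        then show ?thesis using h(2)[of E' r'] ns by auto
      qed simp
      then have "((?F ++ ?t)(s j \<mapsto> k * q + j)) E' = Some r"
        using D E' ns[OF step.hyps(2)] by (auto simp: map_add_def dom_def)
      then show "\<exists>E'. E' \<notin> ?D \<and> ((?F ++ ?t)(s j \<mapsto> k * q + j)) E' = Some r"
        using D by (intro exI[of _ E'] conjI)
    qed
    moreover have "((?F ++ ?t)(s j \<mapsto> k * q + j)) |` (- ?D) = f ++ h(s j \<mapsto> k * q + j)"
    proof
      fix E
      have 1: "h E = None" "E \<noteq> s j" "f E = None" if "E \<in> ?D"
      proof -
        show "E \<noteq> s j" using that s_tower[OF step.hyps(2)] h'_s[OF step.hyps(2)] by auto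
        show "f E = None" using f_D that by (cases "f E") auto
        show "h E = None"
        proof (cases "h E")
          case (Some r)
          then obtain i where "i < q" "E = s i" using h(2) by blast
          then show ?thesis using that s_tower[of i] h'_s[of i] by auto
        qed simp
      qed
      show "(((?F ++ ?t)(s j \<mapsto> k * q + j)) |` (- ?D)) E = (f ++ h(s j \<mapsto> k * q + j)) E"
      proof (cases "E \<in> ?D")
        case True
        then show ?thesis using 1[OF True] by (simp add: map_add_def)
      next
        case False
        then have "h' E = None" "?t E = None" by auto
        then show ?thesis using s_tower[OF step.hyps(2)] h'_s[OF step.hyps(2)]
          by (simp add: map_add_def dom_def)
      qed
    qed
    ultimately have "config n (f ++ h(s j \<mapsto> k * q + j)) H" by simp
    moreover have "(h(s j \<mapsto> k * q + j)) E = Some r \<longleftrightarrow>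
        (\<exists>i. j \<le> i \<and> i < q \<and> E = s i \<and> r = k * q + i)" for E r
      using h(2)[of E r] step.hyps by (cases "E = s j") (auto simp: s_inj dest: le_neq_implies_less)
    ultimately show ?case by blast
  qed
  obtain h where h: "config n (f ++ h) H"
      "\<And>E r. h E = Some r \<longleftrightarrow> (\<exists>i. i < q \<and> E = s i \<and> r = k * q + i)"
    using retain[of 0] by auto
  \<comment> \<open>The retained subblocks supply the rows from \<open>k * q\<close> on; the
    reserved subblock 0 supplies those below.\<close>
  have "\<exists>h'. config n (f ++ h ++ h') H \<and> (\<forall>r < k * q. \<exists>E. h' E = Some r) \<and>
      (\<forall>E r. h' E = Some r \<longrightarrow> r < k * q \<and> links E \<subset> links (block k (sub 0)))"
  proof (rule IH[OF _ refl h(1)])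
    fix E r assume "h E = Some r"
    then obtain i where i: "i < q" "E = s i" "r = k * q + i" using h(2) by blast
    then show "k * q \<le> r \<and> (\<exists>i. i \<noteq> 0 \<and> i \<le> q \<and> E = block k (sub i))"
      by (auto simp: s_def intro!: exI[of _ "Suc i"])
  qed simp
  then obtain h' where h': "config n (f ++ h ++ h') H" "\<And>r. r < k * q \<Longrightarrow> \<exists>E. h' E = Some r"
      "\<And>E r. h' E = Some r \<Longrightarrow> r < k * q" "\<And>E r. h' E = Some r \<Longrightarrow> links E \<subset> links (block k (sub 0))"
    by (elim exE conjE) (rule that, assumption, blast+)
  have "\<exists>E. (h ++ h') E = Some r" if "r < Suc k * q" for r
  proof (cases "r < k * q")
    case True
    then show ?thesis using h'(2) by (meson map_add_find_right)
  next
    case False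
    then have i: "r - k * q < q" "r = k * q + (r - k * q)" using that by auto
    then have "h (s (r - k * q)) = Some r" using h(2) by blast
    moreover have "h' (s (r - k * q)) = None"
    proof (cases "h' (s (r - k * q))")
      case (Some r')
      then show ?thesis using h'(4)[OF Some] disj'[of 0 "Suc (r - k * q)"]
        by (auto simp: s_def links_def block_def)
    qed simp
    ultimately show ?thesis by (metis map_add_Some_iff)
  qed
  moreover have "r < Suc k * q \<and> links E \<subset> links (block (Suc k) p)" if E: "(h ++ h') E = Some r" for E r
  proof -
    consider "h E = Some r" | "h' E = Some r" using E by auto
    then show ?thesis
    proof cases
      case 1
      then obtain i where "i < q" "E = s i" "r = k * q + i" using h(2) by blast
      then show ?thesis using s_psub by simp
    next
      case 2
      then show ?thesis using h'(3,4)[OF 2] sub_block[of 0] by auto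
    qed
  qed
  ultimately show ?case using h'(1) by (intro exI[of _ "h ++ h'"]) (simp add: map_add_assoc)
qed

text \<open>\<open>fill_block\<close> leaves the number of rows unchanged; only the tower in the old
  zone raises it, from \<open>k * q\<close> to \<open>Suc k * q\<close>. The old zone then guards
  the rows while the other zone is filled, and departs completely.\<close>

lemma config_stage:
  assumes "k \<le> K"
  shows "\<exists>f. \<exists>P \<in> bases. config n f (k * q) \<and>
    (\<forall>E r. f E = Some r \<longrightarrow> links E \<subseteq> links (block K P))"
  using assms
proof (induction k)
  case 0
  then show ?case by (intro exI[of _ Map.empty] bexI[of _ 0]) (auto simp: bases_def config.empty)
next
  case (Suc k)
  from Suc.IH[OF Suc_leD[OF Suc.prems]]
  obtain f P where f0: "P \<in> bases" "config n f (k * q)"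
      "\<forall>E r. f E = Some r \<longrightarrow> links E \<subseteq> links (block K P)"
    by (elim exE bexE conjE) (rule that)
  note f = f0(1,2) f0(3)[rule_format]
  \<comment> \<open>Subtraction from the larger base exchanges the two elements of
    \<open>bases\<close>.\<close>
  define P' where "P' = 2 ^ (g * K + 4 + q) - P"
  have P': "P' \<in> bases" "P' \<noteq> P"
    using f(1) by (auto simp: bases_def P'_def)
  have block_zone: "links (block K P) \<subseteq> zone P" for P
    using power_increasing[of "g * K + 3" "g * K + 4 + q" "2::nat"]
    by (auto simp: links_def block_def zone_def)
  let ?F = "f ++ tower P (k * q) q"
  have "config n ?F (max (k * q) (k * q + q))"
  proof (rule config_tower[OF f(2,1) order_refl order_refl])
    show "\<exists>E. f E = Some r \<and> links E \<subseteq> links (block K P)" if "r < k * q" for r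
      using config_row[OF f(2) that] f(3) by blast
    show "r < k * q \<or> k * q + q \<le> r" if "f E = Some r" for E r
      using config_less[OF f(2) that] by simp
    show "f (large P i) = None" for i
    proof (cases "f (large P i)")
      case (Some r)
      then show ?thesis using f(3)[OF Some] block_large[of P i] by blast
    qed simp
  qed
  then have F: "config n ?F (Suc k * q)" by (simp add: add.commute)
  have F_zone: "links E \<subseteq> zone P" if "?F E = Some r" for E r
  proof -
    from that consider "f E = Some r" | "tower P (k * q) q E = Some r" by auto
    then show ?thesis
    proof cases
      case 1
      then show ?thesis using f(3) block_zone by blast
    next
      case 2
      then show ?thesis using tower_iff[of P "k * q" q E r] large_zone[of _ P] by auto
    qed
  qed
  have disj: "zone P \<inter> zone P' = {}" using zones_disjoint f(1) P' by blast
  have mono: "(2::nat) ^ (g * Suc k + 3) \<le> 2 ^ (g * K + 3)"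
    using Suc.prems by (intro power_increasing add_right_mono mult_left_mono) auto
  then have block_P': "links (block (Suc k) P') \<subseteq> links (block K P')"
    by (auto simp: links_def block_def)
  have "\<exists>h. config n (?F ++ h) (Suc k * q) \<and> (\<forall>r < Suc k * q. \<exists>E. h E = Some r) \<and>
      (\<forall>E r. h E = Some r \<longrightarrow> r < Suc k * q \<and> links E \<subset> links (block (Suc k) P'))"
  proof (rule fill_block[OF P'(1) Suc.prems _ order_refl _ F])
    have "g * Suc k + 3 \<le> g * K + 4 + q"
      using mult_le_mono2[OF Suc.prems, of g] by simp
    then show "2 ^ (g * Suc k + 3) dvd P'"
      using P'(1) by (auto simp: bases_def intro: le_imp_power_dvd simp del: mult_Suc_right)
    show "P' + 2 ^ (g * Suc k + 3) \<le> P' + 2 ^ (g * K + 3)" using mono by simp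
    show "links E \<inter> links (block (Suc k) P') = {}" if "?F E = Some r" for E r
      using F_zone[OF that] block_P' block_zone[of P'] disj by blast
    show "Suc k * q \<le> r" if "?F E = Some r" "links E \<inter> zone P' \<noteq> {}" for E r
      using F_zone[OF that(1)] that(2) disj by blast
    show "\<exists>E. ?F E = Some r \<and> links E \<inter> zone P' = {}" if r: "r < Suc k * q" for r
    proof -
      obtain E where E: "?F E = Some r" using config_row[OF F r] by (elim exE)
      then have "links E \<inter> zone P' = {}" using F_zone[OF E] disj by blast
      with E show ?thesis by (intro exI[of _ E] conjI)
    qed
  qed
  then obtain h where h: "config n (?F ++ h) (Suc k * q)" "\<forall>r < Suc k * q. \<exists>E. h E = Some r"
      "\<forall>E r. h E = Some r \<longrightarrow> r < Suc k * q \<and> links E \<subset> links (block (Suc k) P')"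
    by (elim exE conjE)
  have h_F: "?F E = None" if "h E = Some r" for E r
  proof (cases "?F E")
    case (Some r')
    have "links E \<subseteq> zone P'" using h(3) that block_P' block_zone[of P'] by blast
    then show ?thesis
      using F_zone[OF Some] disj links_nonempty[OF config_extents[OF F Some]] by blast
  qed simp
  have "config n ((?F ++ h) |` (- dom ?F)) (Suc k * q)"
  proof (rule config_remove[OF config_finite[OF F] h(1)])
    fix E r assume "(?F ++ h) E = Some r"
    then have "r < Suc k * q" by (rule config_less[OF h(1)])
    then obtain E' where E': "h E' = Some r" using h(2) by blast
    then have "E' \<notin> dom ?F" using h_F by blast
    moreover have "(?F ++ h) E' = Some r" using E' by simp
    ultimately show "\<exists>E'. E' \<notin> dom ?F \<and> (?F ++ h) E' = Some r" by (intro exI[of _ E'] conjI)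
  qed
  moreover have "(?F ++ h) |` (- dom ?F) = h"
  proof
    fix E
    show "((?F ++ h) |` (- dom ?F)) E = h E"
    proof (cases "h E")
      case None
      then show ?thesis by (cases "?F E") (simp_all only: restrict_map_def map_add_def dom_def, simp_all)
    next
      case (Some r)
      then have "E \<notin> dom ?F" using h_F by blast
      then show ?thesis using Some by (simp add: restrict_map_def)
    qed
  qed
  ultimately have "config n h (Suc k * q)" by simp
  moreover have "links E \<subseteq> links (block K P')" if "h E = Some r" for E r
    using h(3) that block_P' by blast
  ultimately show ?case using P'(1) by blast
qed

end

section \<open>Realization by request sequences\<close>

lemma transmission_class_power: "transmission_class x (x + 2 ^ i) = i"
  unfolding transmission_class_def
proof (rule the_equality)
  fix j assume "2 ^ j < 2 * (x + 2 ^ i - x) \<and> x + 2 ^ i - x \<le> 2 ^ j"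
  then have "(2::nat) ^ j < 2 ^ Suc i" "(2::nat) ^ i \<le> 2 ^ j" by simp_all
  then have "j < Suc i" "i \<le> j" by (simp_all only: power_strict_increasing_iff power_increasing_iff)
  then show "j = i" by simp
qed simp

text \<open>The start \<open>x\<close> is a multiple of half the length, so the midpoint is the only
  such multiple crossed. It is the anchor, and \<open>x\<close> is the trail-point. Thus a member of
  \<open>extents n\<close> serves the transmission on its first half.\<close>

lemma extent_power:
  assumes "2 \<le> i" "2 ^ (i - 1) dvd x"
  shows "extent n x (x + 2 ^ i) = (x, min (x + 2 ^ (i + 1)) (n - 1))"
proof -
  let ?m = "2 ^ (i - 1) :: nat"
  have m: "?m > 0" "2 ^ i = 2 * ?m" using assms(1) by (auto simp flip: power_Suc)
  have anchor: "anchor x (x + 2 ^ i) = x + ?m"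
    unfolding anchor_def crosses_def transmission_class_power
  proof (rule Least_equality)
    show "?m dvd x + ?m \<and> x < x + ?m \<and> x + ?m < x + 2 ^ i" using assms(2) m by simp
    fix u assume u: "?m dvd u \<and> x < u \<and> u < x + 2 ^ i"
    then have "?m dvd u - x" using assms(2) by (intro dvd_diff_nat) auto
    then have "?m \<le> u - x" using u by (intro dvd_imp_le) auto
    then show "x + ?m \<le> u" using u by linarith
  qed
  have "trail_point x (x + 2 ^ i) = x"
    unfolding trail_point_def transmission_class_power anchor
  proof (rule Greatest_equality)
    show "?m dvd x \<and> x < x + ?m" using assms(2) m by simp
    fix u assume u: "?m dvd u \<and> u < x + ?m"
    show "u \<le> x"
    proof (rule ccontr)
      assume "\<not> u \<le> x"
      moreover have "?m dvd u - x" using assms(2) u by (intro dvd_diff_nat) auto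
      ultimately have "?m \<le> u - x" by (intro dvd_imp_le) auto
      then show False using u \<open>\<not> u \<le> x\<close> by linarith
    qed
  qed
  then show ?thesis using assms(1) by (simp add: extent_def transmission_class_power)
qed

section \<open>Steps of AllClass as first fit\<close>

lemma add_to_first_update:
  "r < length ws \<Longrightarrow> P (ws ! r) \<Longrightarrow> (\<And>r'. r' < r \<Longrightarrow> \<not> P (ws ! r')) \<Longrightarrow>
    add_to_first P p ws = ws[r := p # ws ! r]"
proof (induction ws arbitrary: r)
  case (Cons w ws)
  show ?case
  proof (cases r)
    case 0
    then show ?thesis using Cons.prems by simp
  next
    case (Suc r')
    have "\<not> P w" using Cons.prems(3)[of 0] Suc by simp
    moreover have "add_to_first P p ws = ws[r' := p # ws ! r']"
    proof (rule Cons.IH)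
      show "\<not> P (ws ! i)" if "i < r'" for i using Cons.prems(3)[of "Suc i"] Suc that by simp
    qed (use Cons.prems Suc in auto)
    ultimately show ?thesis using Suc by simp
  qed
qed simp

lemma open_trail_update:
  assumes "r < length ws" "unused_over E (ws ! r)" "\<And>r'. r' < r \<Longrightarrow> \<not> unused_over E (ws ! r')"
  shows "open_trail E k b ws = ws[r := (E, k, b) # ws ! r]"
proof -
  have "\<exists>w \<in> set ws. unused_over E w" using assms(1,2) nth_mem by blast
  then show ?thesis using assms add_to_first_update unfolding open_trail_def by simp
qed

lemma fill_trails_no_trail:
  "(\<And>w. w \<in> set ws \<Longrightarrow> \<not> has_trail E w) \<Longrightarrow> fill_trails E k b ws = (ws, b)"
  by (induction ws) auto

text \<open>Without a light-trail of this extent there is nothing to fill, so the splittable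
  variation passes on the whole bandwidth and both variations act alike.\<close>

lemma allclass_step_arrive:
  assumes "\<And>w. w \<in> set ws \<Longrightarrow> \<not> has_trail (extent n s d) w" "0 < b"
  shows "allclass_step var n j (Arrive s d b) ws = open_trail (extent n s d) j b ws"
  using assms
  by (cases var) (auto simp: serve_nonsplittable_def serve_splittable_def fill_trails_no_trail)

section \<open>Sequences extended by one event\<close>

lemma allclass_state_append:
  "t \<le> length es \<Longrightarrow> allclass_state var n (es @ es') t = allclass_state var n es t"
  by (induction t) (auto simp: nth_append)

lemma active_append: "t \<le> length es \<Longrightarrow> active (es @ es') t = active es t"
  by (auto simp: active_def nth_append)

lemma valid_append:
  "valid_sequence n (es @ [e]) \<longleftrightarrow> valid_sequence n es \<and>
    (case e of Arrive s d b \<Rightarrow> s < d \<and> d \<le> n - 1 \<and> 0 < b \<and> b \<le> 1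
      | Depart k \<Rightarrow> k < length es \<and> (\<exists>s d b. es ! k = Arrive s d b) \<and> Depart k \<notin> set es)"
    (is "_ \<longleftrightarrow> _ \<and> ?R")
proof -
  define Q where "Q es j \<longleftrightarrow> (case es ! j of Arrive s d b \<Rightarrow> s < d \<and> d \<le> n - 1 \<and> 0 < b \<and> b \<le> 1
      | Depart k \<Rightarrow> k < j \<and> (\<exists>s d b. es ! k = Arrive s d b) \<and> Depart k \<notin> set (take j es))" for es j
  have "Q (es @ [e]) j \<longleftrightarrow> Q es j" if "j < length es" for j
    using that by (cases "es ! j") (auto simp: Q_def nth_append)
  moreover have "Q (es @ [e]) (length es) \<longleftrightarrow> ?R"
    by (cases e) (auto simp: Q_def nth_append)
  moreover have "valid_sequence n es \<longleftrightarrow> (\<forall>j < length es. Q es j)" for es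
    by (simp add: valid_sequence_def Q_def)
  ultimately show ?thesis by (auto simp: less_Suc_eq)
qed

lemma active_arrive:
  assumes "valid_sequence n es"
  shows "active (es @ [Arrive s d b]) (Suc (length es)) = insert (length es) (active es (length es))"
proof -
  have "Depart (length es) \<notin> set es"
  proof
    \<comment> \<open>A valid departure names an earlier position, which \<open>length es\<close> is
      not.\<close>
    assume "Depart (length es) \<in> set es"
    then obtain j where "j < length es" "es ! j = Depart (length es)" by (auto simp: in_set_conv_nth)
    then show False using assms unfolding valid_sequence_def by fastforce
  qed
  then show ?thesis by (auto simp: active_def nth_append less_Suc_eq)
qed

lemma active_depart:
  "active (es @ [Depart k]) (Suc (length es)) = active es (length es) - {k}"
  by (auto simp: active_def nth_append less_Suc_eq)

lemma finite_active [simp]: "finite (active es t)"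
  by (rule finite_subset[of _ "{..<t}"]) (auto simp: active_def)

text \<open>
  \<open>\<kappa> E\<close> is the transmission that keeps the light-trail of extent \<open>E\<close> in existence.
\<close>
definition realizes ::
  "variation \<Rightarrow> nat \<Rightarrow> real \<Rightarrow> event list \<Rightarrow> (segment \<Rightarrow> nat) \<Rightarrow> (segment \<Rightarrow> nat option) \<Rightarrow> nat \<Rightarrow> bool" where
  "realizes var n b es \<kappa> f H \<longleftrightarrow>
     valid_sequence n es \<and> (\<forall>s d b'. Arrive s d b' \<in> set es \<longrightarrow> b' = b) \<and>
     (\<forall>t \<le> length es. card (active es t) \<le> n\<^sup>2) \<and>
     inj_on \<kappa> (dom f) \<and> \<kappa> ` dom f = active es (length es) \<and>
     length (allclass_state var n es (length es)) = H \<and>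
     (\<forall>r<H. set (allclass_state var n es (length es) ! r) = (\<lambda>E. (E, \<kappa> E, b)) ` {E. f E = Some r})"

text \<open>An extent is a pair of nodes. This count is the reason for the bandwidth
  \<open>1 / n^2\<close>.\<close>

lemma card_dom_config:
  assumes "config n f H"
  shows "card (dom f) \<le> n\<^sup>2"
proof -
  have "dom f \<subseteq> {..<n} \<times> {..<n}"
  proof
    fix E assume "E \<in> dom f"
    then have "E \<in> extents n" using config_extents[OF assms] by blast
    then obtain x i where "E = (x, x + 2 ^ (i + 1))" "x + 2 ^ (i + 1) \<le> n - 1"
      by (auto simp: extents_def)
    moreover have "(2::nat) ^ (i + 1) > 0" by simp
    ultimately have "x < n" "x + 2 ^ (i + 1) < n" by linarith+
    then show "E \<in> {..<n} \<times> {..<n}" using \<open>E = _\<close> by simp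
  qed
  then have "card (dom f) \<le> card ({..<n} \<times> {..<n})" by (intro card_mono) auto
  then show ?thesis by (simp add: power2_eq_square)
qed

lemma realizes_append:
  assumes "realizes var n b es \<kappa> f H" "config n f' H'"
    and "valid_sequence n (es @ [e])" "\<And>s d b'. e = Arrive s d b' \<Longrightarrow> b' = b"
    and "inj_on \<kappa>' (dom f')" "\<kappa>' ` dom f' = active (es @ [e]) (Suc (length es))"
    and "ws' = allclass_step var n (length es) e (allclass_state var n es (length es))"
    and "length ws' = H'"
    and "\<And>r. r < H' \<Longrightarrow> set (ws' ! r) = (\<lambda>E. (E, \<kappa>' E, b)) ` {E. f' E = Some r}"
  shows "realizes var n b (es @ [e]) \<kappa>' f' H'"
proof -
  have "card (active (es @ [e]) (Suc (length es))) \<le> n\<^sup>2"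
    using card_dom_config[OF assms(2)] card_image[OF assms(5)] assms(6) by simp
  then have "card (active (es @ [e]) t) \<le> n\<^sup>2" if "t \<le> Suc (length es)" for t
    using that assms(1) by (cases "t = Suc (length es)") (auto simp: realizes_def active_append)
  then show ?thesis
    using assms by (auto simp: realizes_def allclass_state_append)
qed

text \<open>Each rule of \<open>config\<close> costs one event: an arrival on the first half of the
  extent, or the departure of its transmission. Only one transmission is active per extent, so an
  arrival never finds a light-trail of its own extent.\<close>

lemma config_realized:
  assumes "config n f H" "0 < b" "b \<le> 1"
  shows "\<exists>es \<kappa>. realizes var n b es \<kappa> f H"
  using assms(1)
proof induction
  case empty
  have "realizes var n b [] (\<lambda>_. 0) Map.empty 0"
    by (auto simp: realizes_def valid_sequence_def active_def)
  then show ?case by blast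
next
  case (arrive f H E r)
  obtain es \<kappa> where R: "realizes var n b es \<kappa> f H" using arrive.IH by blast
  define ws where "ws = allclass_state var n es (length es)"
  have len: "length ws = H" and rows: "\<And>r. r < H \<Longrightarrow> set (ws ! r) = (\<lambda>E. (E, \<kappa> E, b)) ` {E. f E = Some r}"
    and valid: "valid_sequence n es" and inj: "inj_on \<kappa> (dom f)"
    and keys: "\<kappa> ` dom f = active es (length es)"
    using R by (simp_all add: realizes_def ws_def)
  obtain x i where E: "E = (x, x + 2 ^ (i + 1))" "2 \<le> i" "2 ^ (i - 1) dvd x" "x + 2 ^ (i + 1) \<le> n - 1"
    using arrive.hyps(2) unfolding extents_def by blast
  let ?e = "Arrive x (x + 2 ^ i) b" and ?\<kappa> = "\<kappa>(E := length es)"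
  let ?f = "f(E \<mapsto> r)" and ?H = "max H (Suc r)"
  let ?ws = "open_trail E (length es) b ws"
  have extent: "extent n x (x + 2 ^ i) = E" using extent_power[OF E(2,3), of n] E(4) unfolding E(1) by (simp only: min_absorb1)
  have no_trail: "\<not> has_trail E w" if "w \<in> set ws" for w
  proof
    assume "has_trail E w"
    moreover obtain r' where r': "r' < H" "w = ws ! r'"
      using \<open>w \<in> set ws\<close> len by (auto simp: in_set_conv_nth)
    ultimately have "E \<in> fst ` (\<lambda>E. (E, \<kappa> E, b)) ` {E. f E = Some r'}"
      using rows[OF r'(1)] by (simp add: has_trail_def)
    then show False using arrive.hyps(3) by auto
  qed
  have used: "\<not> unused_over E (ws ! r')" if r': "r' < r" for r'
  proof -
    have "r' < H" using r' arrive.hyps(4) by simp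
    obtain E' where E': "f E' = Some r'" "links E' \<inter> links E \<noteq> {}" using arrive.hyps(5)[OF r'] by (elim exE conjE)
    then have "(E', \<kappa> E', b) \<in> set (ws ! r')" using rows[OF \<open>r' < H\<close>] by blast
    then show ?thesis using E'(2) unfolding unused_over_def by blast
  qed
  have config: "config n ?f ?H" by (rule config.arrive[OF arrive.hyps])
  have fresh: "length es \<notin> \<kappa> ` dom f" unfolding keys by (simp add: active_def)
  have "E \<notin> dom f" using arrive.hyps(3) by auto
  have set_f: "{E'. ?f E' = Some r'} = (if r' = r then insert E {E'. f E' = Some r'} else {E'. f E' = Some r'})" for r'
    using arrive.hyps(3) by auto
  have same: "(\<lambda>E. (E, ?\<kappa> E, b)) ` {E. f E = Some r'} = (\<lambda>E. (E, \<kappa> E, b)) ` {E. f E = Some r'}" for r'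
    using \<open>E \<notin> dom f\<close> by (intro image_cong) auto
  have ws': "length ?ws = ?H \<and> (\<forall>r' < ?H. set (?ws ! r') = (\<lambda>E. (E, ?\<kappa> E, b)) ` {E. ?f E = Some r'})"
  proof (cases "r < H")
    case True
    have "unused_over E (ws ! r)"
      using arrive.hyps(6) rows[OF True] by (auto simp: unused_over_def)
    then have eq: "?ws = ws[r := (E, length es, b) # ws ! r]"
      using open_trail_update[of r ws E] True len used by simp
    have "set (?ws ! r') = (\<lambda>E. (E, ?\<kappa> E, b)) ` {E. ?f E = Some r'}" if "r' < H" for r'
      unfolding set_f using that True len rows[OF that] same[of r']
      by (cases "r' = r") (simp_all add: eq nth_list_update)
    moreover have "?H = H" using True by simp
    ultimately show ?thesis using eq len by simp
  next
    case False
    then have r: "r = H" using arrive.hyps(4) by simp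
    have "{E'. f E' = Some H} = {}" using config_less[OF arrive.hyps(1)] by auto
    have eq: "?ws = ws @ [[(E, length es, b)]]"
      using used r len by (auto simp: open_trail_def in_set_conv_nth)
    have "set (?ws ! r') = (\<lambda>E. (E, ?\<kappa> E, b)) ` {E. ?f E = Some r'}" if "r' < Suc H" for r'
    proof (cases "r' = H")
      case True
      then show ?thesis unfolding set_f using r len \<open>{E'. f E' = Some H} = {}\<close> by (simp add: eq nth_append)
    next
      case False
      then have "r' < H" using that by simp
      then show ?thesis unfolding set_f using r len rows same[of r'] by (simp add: eq nth_append)
    qed
    then show ?thesis using r eq len by simp
  qed
  have "realizes var n b (es @ [?e]) ?\<kappa> ?f ?H"
  proof (rule realizes_append[OF R config])
    have "(2::nat) ^ i \<le> 2 ^ (i + 1)" by simp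
    then have "x + 2 ^ i \<le> n - 1" using E(4) by linarith
    then show "valid_sequence n (es @ [?e])" using valid assms by (simp add: valid_append)
    have "?\<kappa> ` dom f = \<kappa> ` dom f" using \<open>E \<notin> dom f\<close> by (intro image_cong) auto
    then show "inj_on ?\<kappa> (dom ?f)"
      using inj_on_fun_updI[OF inj fresh] fresh \<open>E \<notin> dom f\<close> by simp
    show "?\<kappa> ` dom ?f = active (es @ [?e]) (Suc (length es))"
      using \<open>?\<kappa> ` dom f = \<kappa> ` dom f\<close> unfolding active_arrive[OF valid] keys[symmetric]
      by (simp only: dom_fun_upd image_insert fun_upd_same option.distinct if_False)
    show "?ws = allclass_step var n (length es) ?e (allclass_state var n es (length es))"
      using allclass_step_arrive[of ws n x "x + 2 ^ i" b var "length es"] no_trail extent assms(2)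
      by (simp add: ws_def)
  qed (use ws' in simp_all)
  then show ?case by blast
next
  case (depart f H E r E')
  then obtain es \<kappa> where R: "realizes var n b es \<kappa> f H" by blast
  define ws where "ws = allclass_state var n es (length es)"
  have len: "length ws = H" and rows: "\<And>r. r < H \<Longrightarrow> set (ws ! r) = (\<lambda>E. (E, \<kappa> E, b)) ` {E. f E = Some r}"
    and valid: "valid_sequence n es" and inj: "inj_on \<kappa> (dom f)"
    and keys: "\<kappa> ` dom f = active es (length es)"
    using R by (simp_all add: realizes_def ws_def)
  let ?f = "f(E := None)"
  let ?ws = "map (filter (\<lambda>(E', k', c). k' \<noteq> \<kappa> E)) ws"
  have config: "config n ?f H" by (rule config.depart[OF depart.hyps])
  have E: "E \<in> dom f" using depart.hyps(2) by auto
  have sets: "set (?ws ! r') = (\<lambda>E. (E, \<kappa> E, b)) ` {E. ?f E = Some r'}" if "r' < H" for r'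
  proof -
    have "{E'. ?f E' = Some r'} = {E'. f E' = Some r' \<and> \<kappa> E' \<noteq> \<kappa> E}"
      using inj E by (auto simp: inj_on_def dom_def)
    then have "(\<lambda>E. (E, \<kappa> E, b)) ` {E. ?f E = Some r'} =
        {p \<in> (\<lambda>E. (E, \<kappa> E, b)) ` {E. f E = Some r'}. case p of (E', k', c) \<Rightarrow> k' \<noteq> \<kappa> E}"
      by auto
    then show ?thesis using that len rows[OF that] by (simp only: nth_map set_filter)
  qed
  \<comment> \<open>Rule \<open>depart\<close> leaves another extent in the row, so no wavelength is
    discarded and the numbering survives.\<close>
  have "w \<noteq> []" if w: "w \<in> set ?ws" for w
  proof -
    obtain r' where r': "r' < length ?ws" "?ws ! r' = w" using w unfolding in_set_conv_nth by blast
    then have "r' < H" using len by simp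
    then have "set (?ws ! r') \<noteq> {}"
      unfolding sets[OF \<open>r' < H\<close>] using config_row[OF config] by blast
    then show ?thesis unfolding r'(2) by (simp only: set_empty not_False_eq_True)
  qed
  then have step: "remove_transmission (\<kappa> E) ws = ?ws"
    unfolding remove_transmission_def by (intro filter_True ballI)
  have active: "\<kappa> E \<in> active es (length es)" using keys E by blast
  have "realizes var n b (es @ [Depart (\<kappa> E)]) \<kappa> ?f H"
  proof (rule realizes_append[OF R config])
    show "valid_sequence n (es @ [Depart (\<kappa> E)])"
      using valid active by (simp add: valid_append active_def)
    show "inj_on \<kappa> (dom ?f)" using inj by (simp add: inj_on_diff)
    show "\<kappa> ` dom ?f = active (es @ [Depart (\<kappa> E)]) (Suc (length es))"
      unfolding active_depart keys[symmetric]
      using inj_on_image_set_diff[OF inj, of "dom f" "{E}"] E by simp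
    show "?ws = allclass_step var n (length es) (Depart (\<kappa> E)) (allclass_state var n es (length es))"
      using step by (cases var) (simp_all only: ws_def allclass_step.simps)
  qed (use sets len in simp_all)
  then show ?case by blast
qed

section \<open>The lower bound\<close>

text \<open>The light-trail \<open>(0, n - 1)\<close> on wavelength 0 carries everything. It never
  changes, and one part per transmission is admissible in both variations.\<close>

lemma opt_wavelengths_le_1:
  assumes "2 \<le> n" "valid_sequence n es" "\<And>s d b'. Arrive s d b' \<in> set es \<Longrightarrow> b' = b" "0 < b"
    and "\<And>t. t \<le> length es \<Longrightarrow> real (card (active es t)) * b \<le> 1"
  shows "opt_wavelengths var n es \<le> 1"
proof -
  define sol where "sol = \<lparr>off_shutters = \<lambda>_ _. {0, n - 1}, parts = \<lambda>_. [(0, (0, n - 1), b)]\<rparr>"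
  have "feasible var n es sol"
    unfolding feasible_def
  proof (intro conjI allI impI)
    fix k s d b' assume k: "k < length es" "es ! k = Arrive s d b'"
    then have "d \<le> n - 1" using assms(2) unfolding valid_sequence_def by fastforce
    moreover have "b' = b" using k assms(3) nth_mem by metis
    ultimately show "\<forall>(w, (u, v), c) \<in> set (parts sol k). u \<le> s \<and> d \<le> v \<and> 0 < c"
      "(\<Sum>(w, E, c) \<leftarrow> parts sol k. c) = b'" "length (parts sol k) = 1"
      using assms(4) by (auto simp: sol_def)
  next
    fix t w E assume "t \<le> length es"
    have "trail_load es sol t w E \<le> real (card (active es t)) * b"
      unfolding trail_load_def using assms(4) by (intro sum_bounded_above) (auto simp: sol_def)
    then show "trail_load es sol t w E \<le> 1" using assms(5)[OF \<open>t \<le> length es\<close>] by simp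
  qed (use assms(1) in \<open>auto simp: sol_def is_light_trail_def\<close>)
  then have "opt_wavelengths var n es \<le> solution_wavelengths es sol"
    unfolding opt_wavelengths_def by (intro Least_le) blast
  also have "\<dots> \<le> 1"
  proof -
    have "card (\<Union>k \<in> active es t. fst ` set (parts sol k)) \<le> card {0::nat}" for t
      by (intro card_mono) (auto simp: sol_def)
    then show ?thesis unfolding solution_wavelengths_def by (subst Max_le_iff) auto
  qed
  finally show ?thesis .
qed

theorem theorem8:
  "\<exists>a n\<^sub>0. a > 0 \<and>
     (\<forall>var. \<forall>n::nat \<ge> n\<^sub>0. \<exists>es. es \<noteq> [] \<and> valid_sequence n es \<and>
        real (allclass_wavelengths var n es) \<ge>
          a * ((log 2 (real n))\<^sup>2 / log 2 (log 2 (real n))) * real (opt_wavelengths var n es))"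
proof (rule exI[of _ "1 / 256"], rule exI[of _ "2 ^ 24"], intro conjI allI impI)
  show "(1 / 256 :: real) > 0" by simp
  fix var and n :: nat assume n: "2 ^ 24 \<le> n"
  obtain N where N: "2 ^ N \<le> n" "n < 2 ^ (N + 1)"
    using ex_power_ivl1[of 2 n] n by auto
  have "(2::nat) ^ 24 < 2 ^ (N + 1)" using n N by linarith
  then have "24 \<le> N" by (simp only: power_strict_increasing_iff)
  define q where "q = N div 4"
  have "6 \<le> q" using \<open>24 \<le> N\<close> by (simp add: q_def)
  obtain g\<^sub>0 where g\<^sub>0: "2 ^ g\<^sub>0 \<le> q" "q < 2 ^ (g\<^sub>0 + 1)"
    using ex_power_ivl1[of 2 q] \<open>6 \<le> q\<close> by auto
  \<comment> \<open>This is the least exponent with \<open>q < 2 ^ g\<close>, and doubling costs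
    little: \<open>2 ^ g <= 2 * q <= N div 2\<close>.\<close>
  define g where "g = g\<^sub>0 + 1"
  have g: "q < 2 ^ g" "2 ^ g \<le> N div 2" "1 \<le> g" using g\<^sub>0 by (auto simp: g_def q_def)
  have "g < 2 ^ g" by simp
  then have "g \<le> N div 2" using g by linarith
  define K where "K = (N div 2) div g"
  have gK: "g * K \<le> N div 2" by (simp add: K_def)
  have "1 \<le> K" using \<open>g \<le> N div 2\<close> g by (simp add: K_def div_greater_zero_iff Suc_le_eq)
  \<comment> \<open>Rounding down in \<open>K\<close> loses at most a factor 2, because
    \<open>1 <= K\<close>.\<close>
  have "N div 2 < g * K + g" using g(3) dividend_less_times_div[of g "N div 2"] by (simp add: K_def)
  also have "\<dots> \<le> 2 * (K * g)" using \<open>1 \<le> K\<close> by (simp add: algebra_simps)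
  finally have Kg: "N div 2 \<le> 2 * (K * g)" by simp
  interpret construction n g q K
  proof
    show "q < 2 ^ g" by (rule g)
    \<comment> \<open>The threshold \<open>2 ^ 24\<close> comes from here: N/2 + N/4 + 6 is at most
      N once N is at least 24.\<close>
    have "g * K + q + 5 \<le> N - 1" using gK \<open>24 \<le> N\<close> by (simp add: q_def)
    then have "(2::nat) ^ (g * K + q + 5) \<le> 2 ^ (N - 1)" by (intro power_increasing) auto
    moreover have "(2::nat) ^ N = 2 * 2 ^ (N - 1)" using \<open>24 \<le> N\<close> by (simp flip: power_Suc)
    moreover have "(1::nat) \<le> 2 ^ (N - 1)" by simp
    ultimately show "2 ^ (g * K + q + 5) \<le> n - 1" using N(1) by linarith
  qed
  obtain f where f: "config n f (K * q)" using config_stage[of K] by blast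
  define b where "b = 1 / real (n\<^sup>2)"
  have "0 < n" using n by simp
  then have "1 \<le> real (n\<^sup>2)" by simp
  then have b: "0 < b" "b \<le> 1" using \<open>0 < n\<close> by (simp_all add: b_def divide_le_eq)
  obtain es \<kappa> where es: "realizes var n b es \<kappa> f (K * q)" using config_realized[OF f b] by blast
  have "opt_wavelengths var n es \<le> 1"
  proof (rule opt_wavelengths_le_1)
    show "2 \<le> n" using n by simp
    fix t assume "t \<le> length es"
    then have "card (active es t) \<le> n\<^sup>2" using es by (simp add: realizes_def)
    then have "real (card (active es t)) \<le> real (n\<^sup>2)" by (simp only: of_nat_le_iff)
    then show "real (card (active es t)) * b \<le> 1" using \<open>1 \<le> real (n\<^sup>2)\<close> by (simp add: b_def divide_le_eq)
  qed (use es b in \<open>auto simp: realizes_def\<close>)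
  have used: "K * q \<le> allclass_wavelengths var n es"
    using es unfolding allclass_wavelengths_def realizes_def by (intro Max_ge image_eqI[of _ _ "length es"]) auto
  define l where "l = log 2 (real n)"
  then have l: "real N \<le> l" "l \<le> real N + 1"
    using le_log2_of_power[OF N(1)] log2_of_power_le[OF less_imp_le[OF N(2)]] \<open>0 < n\<close>
    by (simp_all add: l_def)
  \<comment> \<open>The bound on \<open>g\<close> lets \<open>log 2 l\<close> replace
    \<open>g\<close> in the product \<open>K * g * q\<close>; this is the origin of the
    denominator.\<close>
  have "(2::real) ^ g = real (2 ^ g)" by simp
  also have "\<dots> \<le> real N" using g(2) by (simp only: of_nat_le_iff)
  also have "\<dots> \<le> l" by (rule l)
  finally have gl: "real g \<le> log 2 l" by (intro le_log_of_power) auto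
  \<comment> \<open>The constant arises as (1/16)^2: \<open>l\<close> is at most
    \<open>2 * N\<close>, and both \<open>K * g\<close> and \<open>q\<close> are at least
    N/8.\<close>
  have "1 / 256 * l\<^sup>2 \<le> (real N / 8) * (real N / 8)"
  proof -
    have "l\<^sup>2 \<le> (2 * real N)\<^sup>2" using l \<open>24 \<le> N\<close> by (intro power_mono) auto
    then show ?thesis by (simp add: power2_eq_square)
  qed
  also have "\<dots> \<le> real (K * g) * real q"
  proof (intro mult_mono)
    have "N \<le> 8 * (K * g)" using Kg \<open>24 \<le> N\<close> by linarith
    then have "real N \<le> real (8 * (K * g))" by (simp only: of_nat_le_iff)
    then show "real N / 8 \<le> real (K * g)" by simp
    have "N \<le> 8 * q" using \<open>24 \<le> N\<close> by (simp add: q_def)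
    then show "real N / 8 \<le> real q" by linarith
  qed auto
  also have "\<dots> \<le> real (K * q) * log 2 l"
    using mult_left_mono[OF gl, of "real (K * q)"] by (simp add: algebra_simps)
  finally have "1 / 256 * (l\<^sup>2 / log 2 l) \<le> real (K * q)"
    using gl g(3) by (simp add: divide_le_eq)
  moreover have "0 \<le> 1 / 256 * (l\<^sup>2 / log 2 l)" using gl g(3) by simp
  \<comment> \<open>As the bound is nonnegative, a factor of at most 1 can only decrease it.\<close>
  ultimately have "1 / 256 * (l\<^sup>2 / log 2 l) * real (opt_wavelengths var n es) \<le> real (K * q)"
    using \<open>opt_wavelengths var n es \<le> 1\<close> mult_left_le[of "real (opt_wavelengths var n es)" "1 / 256 * (l\<^sup>2 / log 2 l)"]
    by linarith
  also have "\<dots> \<le> real (allclass_wavelengths var n es)" using used by (simp only: of_nat_le_iff)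
  finally have bound: "1 / 256 * (l\<^sup>2 / log 2 l) * real (opt_wavelengths var n es)
      \<le> real (allclass_wavelengths var n es)" .
  have "es \<noteq> []"
  proof
    assume "es = []"
    then have "K * q = 0" using es by (simp add: realizes_def)
    then show False using \<open>1 \<le> K\<close> \<open>6 \<le> q\<close> by simp
  qed
  then show "\<exists>es. es \<noteq> [] \<and> valid_sequence n es \<and>
      real (allclass_wavelengths var n es) \<ge>
        1 / 256 * ((log 2 (real n))\<^sup>2 / log 2 (log 2 (real n))) * real (opt_wavelengths var n es)"
    using bound es by (auto simp: realizes_def l_def)
qed

end
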